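(* Let $G$ be a constant-order locally compact Vilenkin group with sequence of compact open subgroups $\mathscr{G}=\{G_n\}_{n\in\mathbb{Z}}$ and $|G_n/G_{n+1}|=\varkappa$ for all $n\in\mathbb{Z}$. Let $\alpha\in\mathbb{C}$ with $\mathrm{Re}(\alpha)>0$, $\alpha\notin\frac{2\pi i}{\ln\varkappa}\mathbb{Z}$ and $\mathrm{Re}(\alpha)\neq 1$. Then a fundamental solution for the Vladimirov-Taibleson operator $D^\alpha$ on $G$ is given by $$E_\alpha(x)=\frac{1-\varkappa^{-\alpha}}{1-\varkappa^{\alpha-1}}\,|x|_{\mathscr{G}}^{\alpha-1}.$$
   Context: A locally compact Vilenkin group is a locally compact, Hausdorff, totally disconnected, unimodular, type I topological group $G$ endowed with a strictly decreasing sequence $\mathscr{G}=\{G_n\}_{n\in\mathbb{Z}}$ of compact open subgroups such that $|G_n/G_{n+1}|<\infty$ for every $n$, $G=\bigcup_{n\in\mathbb{Z}}G_n$, $\bigcap_{n\in\mathbb{Z}}G_n=\{e\}$, and $\{G_n\}$ is a basis of neighbourhoods at $e$. It is of constant order if $|G_n/G_{n+1}|=\varkappa$ does not depend on $n$. The Haar measure is normalised by $|G_0|=1$, so $|G_n|=\varkappa^{-n}$. Define $|e|_{\mathscr{G}}=0$ and $|x|_{\mathscr{G}}=|G_n|=\varkappa^{-n}$ if $x\in G_n\setminus G_{n+1}$. $\mathcal{D}(G)$ is the space of locally constant complex functions with compact support on $G$. The Vladimirov-Taibleson operator is defined for $f\in\mathcal{D}(G)$ and $\mathrm{Re}(\alpha)>0$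 by $$D^\alpha f(x)=\frac{1-\varkappa^{\alpha}}{1-\varkappa^{-\alpha-1}}\int_G\frac{f(xy^{-1})-f(x)}{|y|_{\mathscr{G}}^{\alpha+1}}\,dy .$$ Convolution is $(g*k)(x)=\int_G g(y)\,k(y^{-1}x)\,dy$. A fundamental solution of $D^\alpha$ is a distribution $E$ (linear functional on $\mathcal{D}(G)$) such that $D^\alpha * E=\delta_e$, that is, $(D^\alpha f)*E=f$ for every $f\in\mathcal{D}(G)$. *)

theory Defs
  imports "HOL-Analysis.Analysis"
begin

text \<open>
  Groups are types of class \<open>topological_group_add\<close>.  This class is written additively but is
  not assumed commutative: \<open>x + y\<close> stands for the product $xy$, \<open>0\<close> for the identity $e$,
  \<open>- x\<close> for $x^{-1}$, \<open>x - y\<close> for $xy^{-1}$, and \<open>- y + x\<close> for $y^{-1}x$.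
\<close>


section \<open>Haar measure and unimodularity\<close>

definition left_haar_measure :: "'a::topological_group_add measure \<Rightarrow> bool" where
  "left_haar_measure \<mu> \<longleftrightarrow>
     sets \<mu> = sets borel \<and>
     emeasure \<mu> UNIV \<noteq> 0 \<and>
     (\<forall>K. compact K \<longrightarrow> K \<in> sets borel \<longrightarrow> emeasure \<mu> K < \<infinity>) \<and>
     (\<forall>A \<in> sets borel. emeasure \<mu> A = (INF U \<in> {U. open U \<and> A \<subseteq> U}. emeasure \<mu> U)) \<and>
     (\<forall>U. open U \<longrightarrow>
        emeasure \<mu> U = (SUP K \<in> {K. compact K \<and> K \<in> sets borel \<and> K \<subseteq> U}. emeasure \<mu> K)) \<and>
     (\<forall>x. \<forall>A \<in> sets borel. emeasure \<mu> ((\<lambda>y. x + y) ` A) = emeasure \<mu> A)"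

definition unimodular_group :: "'a::topological_group_add itself \<Rightarrow> bool" where
  "unimodular_group _ \<longleftrightarrow>
     (\<forall>\<mu> :: 'a measure. left_haar_measure \<mu> \<longrightarrow>
        (\<forall>x. \<forall>A \<in> sets borel. emeasure \<mu> ((\<lambda>y. y + x) ` A) = emeasure \<mu> A))"


section \<open>Type I groups\<close>

text \<open>
  Representation spaces are the closed subspaces of $\ell^2(\mathbb{N})$, that is, up to unitary
  equivalence, all separable Hilbert spaces.  This suffices for a second countable (or just
  $\sigma$-compact first countable) group: every nonzero subrepresentation of a primary
  representation is primary and quasi-equivalent to it, and cyclic subrepresentations act on
  separable spaces.
\<close>

type_synonym cseq = "nat \<Rightarrow> complex"

definition ell2 :: "cseq set" where
  "ell2 = {v. summable (\<lambda>n. (cmod (v n))\<^sup>2)}"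

definition ell2_inner :: "cseq \<Rightarrow> cseq \<Rightarrow> complex" where
  "ell2_inner v w = (\<Sum>n. v n * cnj (w n))"

definition ell2_norm :: "cseq \<Rightarrow> real" where
  "ell2_norm v = sqrt (\<Sum>n. (cmod (v n))\<^sup>2)"

definition closed_subspace :: "cseq set \<Rightarrow> bool" where
  "closed_subspace H \<longleftrightarrow>
     H \<subseteq> ell2 \<and> (\<lambda>n. 0) \<in> H \<and>
     (\<forall>v \<in> H. \<forall>w \<in> H. (\<lambda>n. v n + w n) \<in> H) \<and>
     (\<forall>c. \<forall>v \<in> H. (\<lambda>n. c * v n) \<in> H) \<and>
     (\<forall>v \<in> ell2. (\<forall>\<epsilon>>0. \<exists>w \<in> H. ell2_norm (\<lambda>n. v n - w n) < \<epsilon>) \<longrightarrow> v \<in> H)"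

definition nonzero_space :: "cseq set \<Rightarrow> bool" where
  "nonzero_space H \<longleftrightarrow> (\<exists>v \<in> H. v \<noteq> (\<lambda>n. 0))"

definition linear_map_on :: "cseq set \<Rightarrow> cseq set \<Rightarrow> (cseq \<Rightarrow> cseq) \<Rightarrow> bool" where
  "linear_map_on H K T \<longleftrightarrow>
     (\<forall>v \<in> H. T v \<in> K) \<and>
     (\<forall>v \<in> H. \<forall>w \<in> H. T (\<lambda>n. v n + w n) = (\<lambda>n. T v n + T w n)) \<and>
     (\<forall>c. \<forall>v \<in> H. T (\<lambda>n. c * v n) = (\<lambda>n. c * T v n))"

definition unitary_map_on :: "cseq set \<Rightarrow> cseq set \<Rightarrow> (cseq \<Rightarrow> cseq) \<Rightarrow> bool" where
  "unitary_map_on H K T \<longleftrightarrow>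
     linear_map_on H K T \<and> T ` H = K \<and>
     (\<forall>v \<in> H. \<forall>w \<in> H. ell2_inner (T v) (T w) = ell2_inner v w)"

definition unitary_rep ::
  "cseq set \<Rightarrow> ('a::topological_group_add \<Rightarrow> cseq \<Rightarrow> cseq) \<Rightarrow> bool" where
  "unitary_rep H \<pi> \<longleftrightarrow>
     closed_subspace H \<and>
     (\<forall>g. unitary_map_on H H (\<pi> g)) \<and>
     (\<forall>g h. \<forall>v \<in> H. \<pi> (g + h) v = \<pi> g (\<pi> h v)) \<and>
     (\<forall>v \<in> H. \<forall>g. ((\<lambda>h. ell2_norm (\<lambda>n. \<pi> h v n - \<pi> g v n)) \<longlongrightarrow> 0) (nhds g))"

definition commutant :: "cseq set \<Rightarrow> ('a \<Rightarrow> cseq \<Rightarrow> cseq) \<Rightarrow> (cseq \<Rightarrow> cseq) set" where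
  "commutant H \<pi> =
     {T. linear_map_on H H T \<and>
         (\<exists>C. \<forall>v \<in> H. ell2_norm (T v) \<le> C * ell2_norm v) \<and>
         (\<forall>g. \<forall>v \<in> H. T (\<pi> g v) = \<pi> g (T v))}"

text \<open>Primary (factor) representation: the centre of the commutant consists of scalars.\<close>

definition primary_rep :: "cseq set \<Rightarrow> ('a \<Rightarrow> cseq \<Rightarrow> cseq) \<Rightarrow> bool" where
  "primary_rep H \<pi> \<longleftrightarrow>
     nonzero_space H \<and>
     (\<forall>T \<in> commutant H \<pi>. (\<forall>S \<in> commutant H \<pi>. \<forall>v \<in> H. T (S v) = S (T v)) \<longrightarrow>
        (\<exists>c. \<forall>v \<in> H. T v = (\<lambda>n. c * v n)))"

definition subrep :: "cseq set \<Rightarrow> cseq set \<Rightarrow> ('a \<Rightarrow> cseq \<Rightarrow> cseq) \<Rightarrow> bool" where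
  "subrep K H \<pi> \<longleftrightarrow> closed_subspace K \<and> K \<subseteq> H \<and> (\<forall>g. \<forall>v \<in> K. \<pi> g v \<in> K)"

definition irreducible_rep :: "cseq set \<Rightarrow> ('a \<Rightarrow> cseq \<Rightarrow> cseq) \<Rightarrow> bool" where
  "irreducible_rep H \<pi> \<longleftrightarrow>
     nonzero_space H \<and> (\<forall>K. subrep K H \<pi> \<longrightarrow> nonzero_space K \<longrightarrow> K = H)"

definition equivalent_on :: "cseq set \<Rightarrow> cseq set \<Rightarrow> ('a \<Rightarrow> cseq \<Rightarrow> cseq) \<Rightarrow> bool" where
  "equivalent_on K L \<pi> \<longleftrightarrow>
     (\<exists>T. unitary_map_on K L T \<and> (\<forall>g. \<forall>v \<in> K. T (\<pi> g v) = \<pi> g (T v)))"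

definition multiple_of_irreducible :: "cseq set \<Rightarrow> ('a \<Rightarrow> cseq \<Rightarrow> cseq) \<Rightarrow> bool" where
  "multiple_of_irreducible H \<pi> \<longleftrightarrow>
     (\<exists>\<K>. (\<forall>K \<in> \<K>. subrep K H \<pi> \<and> irreducible_rep K \<pi>) \<and>
          (\<forall>K \<in> \<K>. \<forall>L \<in> \<K>. equivalent_on K L \<pi>) \<and>
          (\<forall>K \<in> \<K>. \<forall>L \<in> \<K>. K \<noteq> L \<longrightarrow> (\<forall>v \<in> K. \<forall>w \<in> L. ell2_inner v w = 0)) \<and>
          (\<forall>M. closed_subspace M \<longrightarrow> (\<forall>K \<in> \<K>. K \<subseteq> M) \<longrightarrow> H \<subseteq> M))"

definition type_I_group :: "'a::topological_group_add itself \<Rightarrow> bool" where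
  "type_I_group _ \<longleftrightarrow>
     (\<forall>H (\<pi> :: 'a \<Rightarrow> cseq \<Rightarrow> cseq).
        unitary_rep H \<pi> \<longrightarrow> primary_rep H \<pi> \<longrightarrow> multiple_of_irreducible H \<pi>)"


section \<open>Locally compact Vilenkin groups\<close>

definition is_subgroup :: "'a::group_add set \<Rightarrow> bool" where
  "is_subgroup H \<longleftrightarrow> 0 \<in> H \<and> (\<forall>x \<in> H. \<forall>y \<in> H. x + y \<in> H) \<and> (\<forall>x \<in> H. - x \<in> H)"

definition left_cosets :: "'a::group_add set \<Rightarrow> 'a set \<Rightarrow> 'a set set" where
  "left_cosets H K = (\<lambda>x. (\<lambda>y. x + y) ` K) ` H"

locale vilenkin_group =
  fixes \<G> :: "int \<Rightarrow> 'a::{topological_group_add, t2_space} set"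
  assumes locally_compact: "locally compact (UNIV :: 'a set)"
    and totally_disconnected: "\<And>S :: 'a set. connected S \<Longrightarrow> \<exists>x. S \<subseteq> {x}"
    and unimodular: "unimodular_group TYPE('a)"
    and type_I: "type_I_group TYPE('a)"
    and subgroup: "\<And>n. is_subgroup (\<G> n)"
    and compact: "\<And>n. compact (\<G> n)"
    and "open": "\<And>n. open (\<G> n)"
    and decreasing: "\<And>n. \<G> (n + 1) \<subset> \<G> n"
    and finite_index: "\<And>n. finite (left_cosets (\<G> n) (\<G> (n + 1)))"
    and Union: "(\<Union>n. \<G> n) = UNIV"
    and Inter: "(\<Inter>n. \<G> n) = {0}"
    and nhds_basis: "\<And>U. open U \<Longrightarrow> 0 \<in> U \<Longrightarrow> \<exists>n. \<G> n \<subseteq> U"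

locale constant_order_vilenkin_group = vilenkin_group \<G>
  for \<G> :: "int \<Rightarrow> 'a::{topological_group_add, t2_space} set" +
  fixes \<kappa> :: nat
  assumes constant_order: "\<And>n. card (left_cosets (\<G> n) (\<G> (n + 1))) = \<kappa>"

definition vnorm :: "'a::topological_group_add measure \<Rightarrow> (int \<Rightarrow> 'a set) \<Rightarrow> 'a \<Rightarrow> real" where
  "vnorm \<mu> \<G> x =
     (if x = 0 then 0 else measure \<mu> (\<G> (THE n. x \<in> \<G> n \<and> x \<notin> \<G> (n + 1))))"


section \<open>The Vladimirov-Taibleson operator and its fundamental solutions\<close>

definition test_functions :: "('a::topological_space \<Rightarrow> complex) set" where
  "test_functions =
     {f. (\<forall>x. \<exists>U. open U \<and> x \<in> U \<and> f constant_on U) \<and> compact (closure {x. f x \<noteq> 0})}"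

text \<open>
  In the next definition the integrand is \<open>0\<close> at \<open>y = 0\<close>, and the base of the complex power is
  a positive real at every other point, so \<open>powr\<close> is the usual power there.
\<close>

definition vladimirov_taibleson ::
  "'a::topological_group_add measure \<Rightarrow> (int \<Rightarrow> 'a set) \<Rightarrow> nat \<Rightarrow> complex \<Rightarrow>
   ('a \<Rightarrow> complex) \<Rightarrow> 'a \<Rightarrow> complex" where
  "vladimirov_taibleson \<mu> \<G> \<kappa> \<alpha> f x =
     (1 - of_nat \<kappa> powr \<alpha>) / (1 - of_nat \<kappa> powr (- \<alpha> - 1)) *
     (LINT y|\<mu>. (f (x - y) - f x) / complex_of_real (vnorm \<mu> \<G> y) powr (\<alpha> + 1))"

definition group_convolution ::
  "'a::topological_group_add measure \<Rightarrow> ('a \<Rightarrow> complex) \<Rightarrow> ('a \<Rightarrow> complex) \<Rightarrow> 'a \<Rightarrow> complex" where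
  "group_convolution \<mu> g k x = (LINT y|\<mu>. g y * k (- y + x))"

definition is_distribution :: "(('a::topological_space \<Rightarrow> complex) \<Rightarrow> complex) \<Rightarrow> bool" where
  "is_distribution T \<longleftrightarrow>
     (\<forall>\<phi> \<in> test_functions. \<forall>\<psi> \<in> test_functions. \<forall>a b.
        T (\<lambda>x. a * \<phi> x + b * \<psi> x) = a * T \<phi> + b * T \<psi>)"

definition regular_distribution ::
  "'a measure \<Rightarrow> ('a \<Rightarrow> complex) \<Rightarrow> ('a \<Rightarrow> complex) \<Rightarrow> complex" where
  "regular_distribution \<mu> E \<phi> = (LINT x|\<mu>. E x * \<phi> x)"

text \<open>
  Fundamental solutions given by a function \<open>E\<close>.  In general $D^\alpha f$ is not compactly
  supported, so $(D^\alpha f) * E$ is the convolution integral rather than a value of the functional;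
  the integrability conditions exclude the value \<open>0\<close> that \<open>LINT\<close> assigns to divergent integrals.
\<close>

definition is_fundamental_solution ::
  "'a::topological_group_add measure \<Rightarrow> (int \<Rightarrow> 'a set) \<Rightarrow> nat \<Rightarrow> complex \<Rightarrow>
   ('a \<Rightarrow> complex) \<Rightarrow> bool" where
  "is_fundamental_solution \<mu> \<G> \<kappa> \<alpha> E \<longleftrightarrow>
     (\<forall>\<phi> \<in> test_functions. integrable \<mu> (\<lambda>x. E x * \<phi> x)) \<and>
     is_distribution (regular_distribution \<mu> E) \<and>
     (\<forall>f \<in> test_functions. \<forall>x.
        integrable \<mu> (\<lambda>y. vladimirov_taibleson \<mu> \<G> \<kappa> \<alpha> f y * E (- y + x)) \<and>
        group_convolution \<mu> (vladimirov_taibleson \<mu> \<G> \<kappa> \<alpha> f) E x = f x)"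

text \<open>
  The value at the identity is \<open>0\<close> for every \<open>\<alpha>\<close>, since \<open>0 powr z = 0\<close>; when
  $\mathrm{Re}(\alpha) < 1$ this replaces an undefined value on a null set.
\<close>

definition fundamental_kernel ::
  "'a::topological_group_add measure \<Rightarrow> (int \<Rightarrow> 'a set) \<Rightarrow> nat \<Rightarrow> complex \<Rightarrow> 'a \<Rightarrow> complex" where
  "fundamental_kernel \<mu> \<G> \<kappa> \<alpha> x =
     (1 - of_nat \<kappa> powr (- \<alpha>)) / (1 - of_nat \<kappa> powr (\<alpha> - 1)) *
     complex_of_real (vnorm \<mu> \<G> x) powr (\<alpha> - 1)"

end

theory Submission
  imports Defs
begin

text \<open>
  Both $D^\alpha$ and $f \mapsto f * E$ commute with left translations, and every test function is a
  finite combination of indicators of left cosets of some $G_n$, so it suffices to treat the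
  indicator of $G_n$.  Its image under $D^\alpha$ is constant on $G_n$ and equal to a multiple of
  $|x|^{-\alpha-1}$ outside.  Convolving at a point \<open>x\<close> outside $G_n$, split the group into
  $|y| < |x|$, $|y| = |x|$ and $|y| > |x|$; by the ultrametric inequality the factor
  $E(y^{-1}x)$ equals $E(x)$ on the first and $E(y)$ on the third part, while on the second part it
  is integrated by left invariance over the ball of radius $|x|$.  For \<open>x\<close> in $G_n$ split at $G_n$
  instead.  All integrals are geometric series over the shells $G_k \setminus G_{k+1}$.
\<close>

section \<open>Integration of functions with countably many values\<close>

text \<open>At each point at most one term of the series is nonzero, so pointwise convergence is
  trivial. The summability hypothesis says that the L1 norms of the terms are summable, which
  justifies integrating term by term.\<close>

lemma has_bochner_integral_disjoint_sum:
  fixes c :: "nat \<Rightarrow> complex"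
  assumes A: "\<And>i. A i \<in> sets M" "\<And>i. emeasure M (A i) < \<infinity>" "disjoint_family A"
    and sum: "summable (\<lambda>i. norm (c i) * measure M (A i))"
    and F: "\<And>i x. x \<in> A i \<Longrightarrow> F x = c i" "\<And>x. x \<notin> (\<Union>i. A i) \<Longrightarrow> F x = 0"
  shows "has_bochner_integral M F (\<Sum>i. c i * measure M (A i))"
proof -
  define f :: "nat \<Rightarrow> 'a \<Rightarrow> complex" where "f i x = indicator (A i) x *\<^sub>R c i" for i x
  have int: "integrable M (f i)" for i
    unfolding f_def using A by (intro integrable_scaleR_left integrable_real_indicator) auto
  have val: "integral\<^sup>L M (f i) = c i * measure M (A i)" for i
    unfolding f_def using A(1,2)[of i] sets.sets_into_space[OF A(1)[of i]]
    by (subst integral_scaleR_left)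
      (auto simp: Int_absorb1 scaleR_conv_of_real mult.commute Int_absorb2)
  have nval: "(\<integral>x. norm (f i x) \<partial>M) = norm (c i) * measure M (A i)" for i
  proof -
    have "(\<integral>x. norm (f i x) \<partial>M) = (\<integral>x. indicator (A i) x *\<^sub>R norm (c i) \<partial>M)"
      by (simp add: f_def)
    also have "\<dots> = norm (c i) * measure M (A i)"
      using A(1,2)[of i] sets.sets_into_space[OF A(1)[of i]]
      by (subst integral_scaleR_left) (auto simp: Int_absorb1 Int_absorb2)
    finally show ?thesis .
  qed
  have single: "\<exists>j. (\<forall>i. i \<noteq> j \<longrightarrow> f i x = 0) \<and> f j x = F x" for x
  proof (cases "x \<in> (\<Union>i. A i)")
    case True
    then obtain j where j: "x \<in> A j" by auto
    then have "x \<notin> A i" if "i \<noteq> j" for i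
      using A(3) that by (auto simp: disjoint_family_on_def)
    with j F(1) show ?thesis by (intro exI[of _ j]) (auto simp: f_def)
  next
    case False
    then show ?thesis using F(2) by (auto simp: f_def)
  qed
  have s: "(\<lambda>i. f i x) sums F x" "summable (\<lambda>i. norm (f i x))" for x
  proof -
    obtain j where j: "\<And>i. i \<noteq> j \<Longrightarrow> f i x = 0" "f j x = F x" using single by blast
    show "(\<lambda>i. f i x) sums F x" using j sums_finite[of "{j}" "\<lambda>i. f i x"] by auto
    show "summable (\<lambda>i. norm (f i x))" using j by (intro summable_finite[of "{j}"]) auto
  qed
  have F_eq: "F = (\<lambda>x. \<Sum>i. f i x)" using s(1) by (auto simp: sums_iff)
  have sm: "summable (\<lambda>i. \<integral>x. norm (f i x) \<partial>M)" using sum by (simp add: nval)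
  have "integrable M F"
    unfolding F_eq by (rule integrable_suminf[OF int _ sm]) (use s in auto)
  moreover have "integral\<^sup>L M F = (\<Sum>i. c i * measure M (A i))"
    unfolding F_eq by (subst integral_suminf[OF int _ sm]) (use s in \<open>auto simp: val\<close>)
  ultimately show ?thesis by (simp add: has_bochner_integral_iff)
qed

text \<open>Turns shell contributions moving away from the identity into a geometric series with
  ratio \<open>inverse r\<close>.\<close>

lemma powi_diff_nat:
  "r \<noteq> 0 \<Longrightarrow> r powi (m - 1 - int i) = r powi m / r * inverse r ^ i" for r :: complex
  by (simp add: power_int_diff power_int_add power_inverse field_simps)

section \<open>Haar measure on the chain of subgroups\<close>

locale haar_vilenkin_group = constant_order_vilenkin_group \<G> \<kappa>
  for \<G> :: "int \<Rightarrow> 'a::{topological_group_add, t2_space} set" and \<kappa> :: nat +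
  fixes \<mu> :: "'a measure"
  assumes haar: "left_haar_measure \<mu>" and normalized: "emeasure \<mu> (\<G> 0) = 1"
begin

lemma zero_mem [simp]: "0 \<in> \<G> n"
  and add_mem: "x \<in> \<G> n \<Longrightarrow> y \<in> \<G> n \<Longrightarrow> x + y \<in> \<G> n"
  and minus_mem: "x \<in> \<G> n \<Longrightarrow> - x \<in> \<G> n"
  using subgroup[of n] by (auto simp: is_subgroup_def)

lemma minus_mem_iff [simp]: "- x \<in> \<G> n \<longleftrightarrow> x \<in> \<G> n"
  using minus_mem[of x n] minus_mem[of "- x" n] by auto

lemma add_mem_iff_left: "x \<in> \<G> n \<Longrightarrow> x + y \<in> \<G> n \<longleftrightarrow> y \<in> \<G> n"
  using add_mem[of x n y] add_mem[of "- x" n "x + y"] by auto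

lemma antimono_G: "m \<le> n \<Longrightarrow> \<G> n \<subseteq> \<G> m"
proof (induction n rule: int_ge_induct)
  case (step i)
  then show ?case using decreasing[of i] by blast
qed simp

lemma sets_mu [measurable_cong, simp]: "sets \<mu> = sets borel"
  using haar by (simp add: left_haar_measure_def)

lemma space_mu [simp]: "space \<mu> = UNIV"
  using sets_eq_imp_space_eq[OF sets_mu] by simp

lemma G_borel [measurable, simp]: "\<G> n \<in> sets borel"
  using "open"[of n] by simp

lemma emeasure_G_finite: "emeasure \<mu> (\<G> n) < \<infinity>"
  using haar compact[of n] unfolding left_haar_measure_def by (metis G_borel)

lemma emeasure_left:
  "A \<in> sets borel \<Longrightarrow> emeasure \<mu> ((\<lambda>y. x + y) ` A) = emeasure \<mu> A"
  using haar unfolding left_haar_measure_def by blast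

lemma emeasure_right:
  "A \<in> sets borel \<Longrightarrow> emeasure \<mu> ((\<lambda>y. y + x) ` A) = emeasure \<mu> A"
  using haar unimodular unfolding unimodular_group_def by blast

lemma left_translation_measurable [measurable]: "(\<lambda>y. x + y) \<in> \<mu> \<rightarrow>\<^sub>M \<mu>"
proof -
  have "(\<lambda>y. x + y) \<in> borel \<rightarrow>\<^sub>M borel"
    by (intro borel_measurable_continuous_onI continuous_intros)
  then show ?thesis by (simp add: measurable_cong_sets[OF sets_mu sets_mu])
qed

lemma left_translation_distr: "distr \<mu> \<mu> (\<lambda>y. x + y) = \<mu>"
proof (rule measure_eqI)
  fix A assume "A \<in> sets (distr \<mu> \<mu> (\<lambda>y. x + y))"
  then have A: "A \<in> sets borel" by simp
  have "(\<lambda>y. x + y) -` A = (\<lambda>y. - x + y) ` A"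
    by (auto simp: image_iff intro!: bexI[of _ "x + _"] simp flip: add.assoc)
  then show "emeasure (distr \<mu> \<mu> (\<lambda>y. x + y)) A = emeasure \<mu> A"
    using A by (simp add: emeasure_distr emeasure_left)
qed simp

text \<open>The direction from the translate to \<open>f\<close> lets an integral be established
  after a convenient change of variable.\<close>

lemma has_bochner_integral_left_translation:
  fixes f :: "'a \<Rightarrow> complex"
  assumes "has_bochner_integral \<mu> (\<lambda>y. f (x + y)) c"
  shows "has_bochner_integral \<mu> f c"
proof -
  have *: "integrable \<mu> (\<lambda>y. f (x + y))" "integral\<^sup>L \<mu> (\<lambda>y. f (x + y)) = c"
    using assms by (auto simp: has_bochner_integral_iff)
  from borel_measurable_integrable[OF *(1)]
  \<comment> \<open>Measurability of \<open>f\<close> is recovered by translating back by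
    \<open>- x\<close>.\<close>
  have "(\<lambda>y. f (x + (- x + y))) \<in> borel_measurable \<mu>" by measurable
  then have f: "f \<in> borel_measurable \<mu>" by (simp flip: add.assoc)
  then show ?thesis
    using * integrable_distr_eq[of "(+) x" \<mu> \<mu> f] integral_distr[of "(+) x" \<mu> \<mu> f]
    by (simp add: left_translation_distr has_bochner_integral_iff)
qed

lemma order_ge_2: "2 \<le> \<kappa>"
proof -
  \<comment> \<open>The index \<open>0 + 1\<close> stays unevaluated so that
    \<open>constant_order\<close> applies at \<open>0\<close>.\<close>
  let ?C = "left_cosets (\<G> 0) (\<G> (0 + 1))"
  obtain x where x: "x \<in> \<G> 0" "x \<notin> \<G> (0 + 1)" using decreasing[of 0] by blast
  have "(\<lambda>y. 0 + y) ` \<G> (0 + 1) \<in> ?C" "(\<lambda>y. x + y) ` \<G> (0 + 1) \<in> ?C"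
    unfolding left_cosets_def using x by (auto simp del: add_0_left)
  moreover have "x + 0 \<in> (\<lambda>y. x + y) ` \<G> (0 + 1)" by (intro imageI zero_mem)
  then have "(\<lambda>y. 0 + y) ` \<G> (0 + 1) \<noteq> (\<lambda>y. x + y) ` \<G> (0 + 1)" using x by auto
  ultimately have "card {(\<lambda>y. 0 + y) ` \<G> (0 + 1), (\<lambda>y. x + y) ` \<G> (0 + 1)} \<le> card ?C"
    by (intro card_mono finite_index) auto
  with \<open>_ \<noteq> _\<close> show ?thesis unfolding constant_order by simp
qed

lemma mem_left_coset: "(x :: 'a) \<in> (\<lambda>y. a + y) ` A \<longleftrightarrow> - a + x \<in> A"
proof
  assume "- a + x \<in> A"
  then have "a + (- a + x) \<in> (\<lambda>y. a + y) ` A" by (rule imageI)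
  then show "x \<in> (\<lambda>y. a + y) ` A" by (simp only: add_minus_cancel)
qed (auto simp only: minus_add_cancel)

text \<open>This makes the left cosets of \<open>\<G> n\<close> a partition, both for adding up
  measures and for splitting a test function. It holds because \<open>- a + y\<close> and
  \<open>- x + y\<close> differ by the left factor \<open>- a + x\<close>, which lies in the
  subgroup.\<close>

lemma mem_left_coset_trans:
  assumes "x \<in> (\<lambda>y. a + y) ` \<G> n"
  shows "(\<lambda>y. x + y) ` \<G> n = (\<lambda>y. a + y) ` \<G> n"
proof -
  have "- a + x \<in> \<G> n" using assms by (simp only: mem_left_coset)
  moreover have "- a + y = (- a + x) + (- x + y)" for y by (simp add: add.assoc flip: add.assoc)
  ultimately have "- x + y \<in> \<G> n \<longleftrightarrow> - a + y \<in> \<G> n" for y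
    using add_mem_iff_left by metis
  then show ?thesis by (auto simp only: mem_left_coset set_eq_iff)
qed

lemma left_coset_open: "open ((\<lambda>y. x + y) ` \<G> n)"
proof -
  have "(\<lambda>y. x + y) ` \<G> n = (\<lambda>y. - x + y) -` \<G> n"
    by (auto simp only: mem_left_coset set_eq_iff vimage_eq)
  then show ?thesis by (auto intro!: open_vimage "open" continuous_intros)
qed

text \<open>The \<open>\<kappa>\<close> left cosets of \<open>\<G> (n + 1)\<close> partition
  \<open>\<G> n\<close>, and left invariance gives them equal measure.\<close>

lemma measure_G_Suc: "measure \<mu> (\<G> n) = \<kappa> * measure \<mu> (\<G> (n + 1))"
proof -
  let ?C = "left_cosets (\<G> n) (\<G> (n + 1))"
  have sub: "\<G> (n + 1) \<subseteq> \<G> n" by (rule antimono_G) simp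
  have U: "\<G> n = \<Union>?C"
  proof (intro equalityI subsetI)
    fix x assume x: "x \<in> \<G> n"
    have "x \<in> (\<lambda>y. x + y) ` \<G> (n + 1)" by (simp add: mem_left_coset)
    with x show "x \<in> \<Union>?C" unfolding left_cosets_def by blast
  next
    fix x assume "x \<in> \<Union>?C"
    then show "x \<in> \<G> n" using sub by (auto simp: left_cosets_def intro: add_mem)
  qed
  have "measure \<mu> (\<Union>?C) = (\<Sum>c\<in>?C. measure \<mu> c)"
  proof (rule measure_Union'[OF finite_index])
    fix c assume "c \<in> ?C"
    then obtain x where "c = (\<lambda>y. x + y) ` \<G> (n + 1)" by (auto simp: left_cosets_def)
    then show "c \<in> fmeasurable \<mu>"
      using emeasure_left[of "\<G> (n + 1)" x] emeasure_G_finite[of "n + 1"]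
        left_coset_open[of x "n + 1"]
      by (auto intro!: fmeasurableI)
  next
    show "pairwise disjnt ?C"
    proof (rule pairwiseI, rule ccontr)
      fix c d assume cd: "c \<in> ?C" "d \<in> ?C" "c \<noteq> d" "\<not> disjnt c d"
      then obtain x where "x \<in> c" "x \<in> d" by (auto simp: disjnt_def)
      with cd have "c = (\<lambda>y. x + y) ` \<G> (n + 1)" "d = (\<lambda>y. x + y) ` \<G> (n + 1)"
        unfolding left_cosets_def using mem_left_coset_trans by (smt (verit) imageE)+
      with cd show False by simp
    qed
  qed
  also have "\<dots> = (\<Sum>c\<in>?C. measure \<mu> (\<G> (n + 1)))"
    by (intro sum.cong refl) (auto simp: left_cosets_def measure_def emeasure_left)
  finally show ?thesis using U by (simp add: constant_order)
qed

lemma measure_G: "measure \<mu> (\<G> n) = \<kappa> powi (- n)"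
proof (induction n rule: int_induct[where k = 0])
  case base
  then show ?case using normalized by (simp add: measure_def)
next
  case (step1 i)
  then show ?case using measure_G_Suc[of i] order_ge_2
    by (simp add: power_int_add power_int_minus power_int_diff field_simps)
next
  case (step2 i)
  then show ?case using measure_G_Suc[of "i - 1"] order_ge_2
    by (simp add: power_int_add power_int_minus power_int_diff field_simps)
qed

section \<open>Levels and radial functions\<close>

text \<open>This repeats the description inside \<open>vnorm\<close>, so that \<open>vnorm\<close>
  at a nonzero point is the measure of \<open>\<G> (level x)\<close>. Large levels lie near the
  identity. At \<open>0\<close> the value is unspecified, and \<open>rad\<close> treats that point
  separately.\<close>

definition level :: "'a \<Rightarrow> int" where
  "level x = (THE n. x \<in> \<G> n \<and> x \<notin> \<G> (n + 1))"

lemma level_eqI: "x \<in> \<G> n \<Longrightarrow> x \<notin> \<G> (n + 1) \<Longrightarrow> level x = n"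
  unfolding level_def
proof (rule the_equality, blast)
  fix m assume x: "x \<in> \<G> n" "x \<notin> \<G> (n + 1)" and m: "x \<in> \<G> m \<and> x \<notin> \<G> (m + 1)"
  have "\<not> n + 1 \<le> m" "\<not> m + 1 \<le> n" using x m antimono_G by blast+
  then show "m = n" by simp
qed

text \<open>If \<open>x\<close> never left the chain, membership in one \<open>\<G> k\<close> would
  propagate to all larger indices and, by monotonicity, to all smaller ones, forcing
  \<open>x\<close> into the trivial intersection.\<close>

lemma level_exists: "x \<noteq> 0 \<Longrightarrow> \<exists>n. x \<in> \<G> n \<and> x \<notin> \<G> (n + 1)"
proof (rule ccontr)
  assume x: "x \<noteq> 0" and "\<nexists>n. x \<in> \<G> n \<and> x \<notin> \<G> (n + 1)"
  then have step: "x \<in> \<G> (n + 1)" if "x \<in> \<G> n" for n using that by blast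
  obtain k where k: "x \<in> \<G> k" using Union by blast
  obtain m where m: "x \<notin> \<G> m" using Inter x by blast
  have "x \<in> \<G> n" if "k \<le> n" for n using that by (induction n rule: int_ge_induct) (use k step in auto)
  then show False using m antimono_G[of m k] k by (cases "k \<le> m") auto
qed

lemma mem_G_iff_level: "x \<noteq> 0 \<Longrightarrow> x \<in> \<G> n \<longleftrightarrow> n \<le> level x"
proof -
  assume "x \<noteq> 0"
  then obtain k where k: "x \<in> \<G> k" "x \<notin> \<G> (k + 1)" using level_exists by blast
  then have "level x = k" by (rule level_eqI)
  then show ?thesis using k antimono_G[of n k] antimono_G[of "k + 1" n] by (cases "n \<le> k") auto
qed

text \<open>The equality case of the ultrametric inequality: \<open>y\<close> lies in both subgroups
  that test the level of \<open>x\<close>, so adding it changes neither membership.\<close>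

lemma level_add:
  assumes "x \<notin> \<G> n" "y \<in> \<G> n"
  shows "level (y + x) = level x"
proof -
  have "x \<noteq> 0" using assms(1) by auto
  then have lt: "level x < n" using mem_G_iff_level assms(1) by force
  have y: "y \<in> \<G> (level x)" "y \<in> \<G> (level x + 1)"
    using assms(2) antimono_G[of "level x" n] antimono_G[of "level x + 1" n] lt by auto
  have x: "x \<in> \<G> (level x)" "x \<notin> \<G> (level x + 1)"
    using mem_G_iff_level[OF \<open>x \<noteq> 0\<close>] by auto
  show ?thesis by (rule level_eqI; use x y in \<open>simp add: add_mem_iff_left\<close>)
qed

lemma level_minus [simp]: "level (- x) = level x"
  by (simp add: level_def)

text \<open>For \<open>r\<close> the power of \<open>\<kappa>\<close> with exponent \<open>s\<close>
  this is the norm raised to \<open>- s\<close>. The weight of the operator and the kernel both have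
  this shape, which keeps complex powers and their branches out of the integral computations. The
  value at \<open>0\<close> matches \<open>0 powr z = 0\<close>.\<close>

definition rad :: "complex \<Rightarrow> 'a \<Rightarrow> complex" where
  "rad r x = (if x = 0 then 0 else r powi level x)"

lemma rad_0 [simp]: "rad r 0 = 0"
  by (simp add: rad_def)

lemma rad_minus [simp]: "rad r (- x) = rad r x"
  by (simp add: rad_def)

lemma rad_mult: "rad r x * rad s x = rad (r * s) x"
  by (simp add: rad_def power_int_mult_distrib)

lemma rad_add:
  assumes "x \<notin> \<G> n" "y \<in> \<G> n"
  shows "rad r (y + x) = rad r x"
proof -
  have "y + x \<notin> \<G> n" "x \<noteq> 0" using assms by (auto simp: add_mem_iff_left)
  then have "y + x \<noteq> 0" using zero_mem by metis
  with \<open>x \<noteq> 0\<close> show ?thesis using level_add[OF assms] by (simp add: rad_def)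
qed

lemma rad_minus_add:
  assumes "x \<notin> \<G> n" "y \<in> \<G> n"
  shows "rad r (- y + x) = rad r x" "rad r (- x + y) = rad r x"
proof -
  show "rad r (- y + x) = rad r x" using assms by (intro rad_add) auto
  moreover have "- x + y = - (- y + x)" by (simp add: minus_add)
  ultimately show "rad r (- x + y) = rad r x" by (simp only: rad_minus)
qed

lemma kappa_gt_1: "1 < real \<kappa>"
  using order_ge_2 by simp

section \<open>Radial integrals as geometric series over shells\<close>

lemma shell:
  "\<G> n - \<G> (n + 1) \<in> sets \<mu>" "emeasure \<mu> (\<G> n - \<G> (n + 1)) < \<infinity>"
  "measure \<mu> (\<G> n - \<G> (n + 1)) = (1 - 1 / \<kappa>) * \<kappa> powi (- n)"
proof -
  have G: "\<G> k \<in> fmeasurable \<mu>" for k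
    using emeasure_G_finite[of k] by (auto intro!: fmeasurableI)
  then have "\<G> n - \<G> (n + 1) \<in> fmeasurable \<mu>" by (intro fmeasurable_Diff) auto
  then show "\<G> n - \<G> (n + 1) \<in> sets \<mu>" "emeasure \<mu> (\<G> n - \<G> (n + 1)) < \<infinity>"
    by (auto simp: fmeasurable_def)
  have "measure \<mu> (\<G> n - \<G> (n + 1)) = measure \<mu> (\<G> n) - measure \<mu> (\<G> (n + 1))"
    using G antimono_G[of n "n + 1"] emeasure_G_finite[of n] by (intro measure_Diff) (auto simp: less_top)
  then show "measure \<mu> (\<G> n - \<G> (n + 1)) = (1 - 1 / \<kappa>) * \<kappa> powi (- n)"
    using kappa_gt_1 by (simp add: measure_G power_int_diff power_int_minus field_simps power_int_add)
qed

lemma shell_iff: "x \<in> \<G> n - \<G> (n + 1) \<longleftrightarrow> x \<noteq> 0 \<and> level x = n"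
proof (cases "x = 0")
  case False
  then show ?thesis using mem_G_iff_level[OF False, of n] mem_G_iff_level[OF False, of "n + 1"] by auto
qed simp

text \<open>A shell has measure proportional to \<open>\<kappa> powi (- n)\<close>, so the shell
  contributions form a geometric progression with ratio \<open>r / of_nat \<kappa>\<close>.\<close>

lemma shell_term:
  "r powi n * complex_of_real (measure \<mu> (\<G> n - \<G> (n + 1))) =
    (1 - 1 / of_nat \<kappa>) * (r / of_nat \<kappa>) powi n"
  unfolding shell(3) by (simp add: power_int_divide_distrib power_int_minus field_simps)

text \<open>The shells inside the ball have indices \<open>m\<close>, \<open>m + 1\<close> and so
  on, and the bound on \<open>norm r\<close> makes the ratio smaller than 1 in norm.\<close>

lemma rad_integral_ball:
  assumes r: "r \<noteq> 0" "norm r < \<kappa>"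
  shows "has_bochner_integral \<mu> (\<lambda>x. indicator (\<G> m) x * rad r x)
    ((1 - 1 / of_nat \<kappa>) * (r / of_nat \<kappa>) powi m / (1 - r / of_nat \<kappa>))"
proof -
  define A where "A i = \<G> (m + int i) - \<G> (m + int i + 1)" for i
  define c where "c i = r powi (m + int i)" for i
  have k: "complex_of_nat \<kappa> \<noteq> 0" using order_ge_2 by simp
  have term_eq: "c i * measure \<mu> (A i) = (1 - 1 / of_nat \<kappa>) * (r / of_nat \<kappa>) powi m * (r / of_nat \<kappa>) ^ i" for i
    unfolding c_def A_def shell_term using r k by (simp add: power_int_add)
  have "norm (r / of_nat \<kappa>) < 1" using r kappa_gt_1 by (simp add: norm_divide)
  then have sums: "(\<lambda>i. c i * measure \<mu> (A i)) sums ((1 - 1 / of_nat \<kappa>) * (r / of_nat \<kappa>) powi m * (1 / (1 - r / of_nat \<kappa>)))"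
    and summ: "summable (\<lambda>i. norm ((1 - 1 / of_nat \<kappa>) * (r / of_nat \<kappa>) powi m) * norm (r / of_nat \<kappa>) ^ i)"
    unfolding term_eq by (intro sums_mult geometric_sums summable_mult summable_geometric; simp)+
  have "has_bochner_integral \<mu> (\<lambda>x. indicator (\<G> m) x * rad r x) (\<Sum>i. c i * measure \<mu> (A i))"
  proof (rule has_bochner_integral_disjoint_sum)
    show "A i \<in> sets \<mu>" "emeasure \<mu> (A i) < \<infinity>" for i unfolding A_def by (rule shell)+
    show "disjoint_family A" unfolding disjoint_family_on_def A_def
      using shell_iff by (smt (verit) disjoint_iff of_nat_eq_iff)
    have "norm (c i) * measure \<mu> (A i) = norm (c i * measure \<mu> (A i))" for i
      by (simp add: norm_mult)
    then show "summable (\<lambda>i. norm (c i) * measure \<mu> (A i))"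
      using summ unfolding term_eq by (simp only: norm_mult norm_power)
    show "indicator (\<G> m) x * rad r x = c i" if "x \<in> A i" for i x
      using that unfolding A_def shell_iff by (simp add: c_def rad_def mem_G_iff_level)
    \<comment> \<open>Inside \<open>\<G> m\<close> only the identity lies on none of these shells,
      and \<open>rad\<close> is 0 there.\<close>
    show "indicator (\<G> m) x * rad r x = 0" if x: "x \<notin> (\<Union>i. A i)" for x
    proof (cases "x \<noteq> 0 \<and> x \<in> \<G> m")
      case True
      then have "x \<in> A (nat (level x - m))" unfolding A_def shell_iff
        by (auto simp: mem_G_iff_level)
      with x show ?thesis by blast
    qed auto
  qed
  then show ?thesis using sums by (simp add: sums_iff)
qed

text \<open>Here the shells run away from the identity, so the ratio is inverted and convergence
  needs the opposite bound on \<open>norm r\<close>.\<close>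

lemma rad_integral_compl:
  assumes r: "\<kappa> < norm r"
  shows "has_bochner_integral \<mu> (\<lambda>x. indicator (- \<G> m) x * rad r x)
    ((1 - 1 / of_nat \<kappa>) * (r / of_nat \<kappa>) powi m / (r / of_nat \<kappa> - 1))"
proof -
  \<comment> \<open>The first shell outside \<open>\<G> m\<close> is
    \<open>\<G> (m - 1) - \<G> m\<close>, hence the shift by 1.\<close>
  define A where "A i = \<G> (m - 1 - int i) - \<G> (m - 1 - int i + 1)" for i
  define c where "c i = r powi (m - 1 - int i)" for i
  have k: "complex_of_nat \<kappa> \<noteq> 0" using order_ge_2 by simp
  have r0: "r \<noteq> 0" "r \<noteq> of_nat \<kappa>" using r by auto
  define s where "s = r / of_nat \<kappa>"
  have s0: "s \<noteq> 0" "s \<noteq> 1" using r0 k by (auto simp: s_def)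
  have term_eq: "c i * measure \<mu> (A i) = (1 - 1 / of_nat \<kappa>) * s powi m / s * inverse s ^ i" for i
  proof -
    have "c i * measure \<mu> (A i) = (1 - 1 / of_nat \<kappa>) * s powi (m - 1 - int i)"
      unfolding c_def A_def shell_term s_def ..
    then show ?thesis using s0 by (simp add: powi_diff_nat)
  qed
  have n1: "norm (inverse s) < 1" using r kappa_gt_1 unfolding s_def
    by (simp add: norm_divide norm_inverse divide_less_eq)
  then have sums: "(\<lambda>i. c i * measure \<mu> (A i)) sums ((1 - 1 / of_nat \<kappa>) * s powi m / s * (1 / (1 - inverse s)))"
    and summ: "summable (\<lambda>i. norm ((1 - 1 / of_nat \<kappa>) * s powi m / s) * norm (inverse s) ^ i)"
    unfolding term_eq by (intro sums_mult geometric_sums summable_mult summable_geometric; simp)+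
  have "has_bochner_integral \<mu> (\<lambda>x. indicator (- \<G> m) x * rad r x) (\<Sum>i. c i * measure \<mu> (A i))"
  proof (rule has_bochner_integral_disjoint_sum)
    show "A i \<in> sets \<mu>" "emeasure \<mu> (A i) < \<infinity>" for i unfolding A_def by (rule shell)+
    show "disjoint_family A" unfolding disjoint_family_on_def A_def
      using shell_iff by (smt (verit) disjoint_iff of_nat_eq_iff)
    have "norm (c i) * measure \<mu> (A i) = norm (c i * measure \<mu> (A i))" for i
      by (simp add: norm_mult)
    then show "summable (\<lambda>i. norm (c i) * measure \<mu> (A i))"
      using summ unfolding term_eq by (simp only: norm_mult norm_power)
    show "indicator (- \<G> m) x * rad r x = c i" if "x \<in> A i" for i x
      using that unfolding A_def shell_iff by (simp add: c_def rad_def mem_G_iff_level)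
    show "indicator (- \<G> m) x * rad r x = 0" if x: "x \<notin> (\<Union>i. A i)" for x
    proof (cases "x \<noteq> 0 \<and> x \<notin> \<G> m")
      case True
      then have "x \<in> A (nat (m - 1 - level x))" unfolding A_def shell_iff
        by (auto simp: mem_G_iff_level)
      with x show ?thesis by blast
    qed auto
  qed
  moreover have "(1 - 1 / of_nat \<kappa>) * s powi m / s * (1 / (1 - inverse s)) =
      (1 - 1 / of_nat \<kappa>) * s powi m / (s - 1)"
    using s0 by (simp add: field_simps)
  ultimately show ?thesis using sums unfolding s_def[symmetric] sums_iff by (simp only:)
qed

section \<open>The operator applied to indicators of balls\<close>

text \<open>
  With \<open>a\<close> standing for $\varkappa^\alpha$, this is $D^\alpha$ of the indicator of $G_n$ without the
  constant in front of the integral.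
\<close>

definition ball_operator :: "complex \<Rightarrow> int \<Rightarrow> 'a \<Rightarrow> complex" where
  "ball_operator a n x =
    (if x \<in> \<G> n then - (1 - 1 / of_nat \<kappa>) * a powi n / (a - 1)
     else of_nat \<kappa> powi (- n) * rad (a * of_nat \<kappa>) x)"

lemma has_bochner_integral_indicator_G:
  "has_bochner_integral \<mu> (\<lambda>x. indicator (\<G> n) x * c) (of_nat \<kappa> powi (- n) * c)" for c :: complex
proof -
  have "has_bochner_integral \<mu> (\<lambda>x. indicator (\<G> n) x *\<^sub>R c) (measure \<mu> (\<G> n) *\<^sub>R c)"
    using emeasure_G_finite[of n]
    by (intro has_bochner_integral_scaleR_left has_bochner_integral_real_indicator) auto
  then show ?thesis
    by (simp add: measure_G scaleR_conv_of_real of_real_indicator)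
qed

lemma has_bochner_integral_ball_operator:
  assumes a: "1 < norm a"
  shows "has_bochner_integral \<mu>
    (\<lambda>y. (indicator (\<G> n) (x - y) - indicator (\<G> n) x) * rad (a * of_nat \<kappa>) y)
    (ball_operator a n x)"
proof (cases "x \<in> \<G> n")
  case True
  have k: "complex_of_nat \<kappa> \<noteq> 0" using order_ge_2 by simp
  \<comment> \<open>Since \<open>x\<close> lies in the subgroup, \<open>x - y\<close> does exactly
    when \<open>y\<close> does, so only the complement of the ball contributes, with a minus
    sign.\<close>
  have "has_bochner_integral \<mu> (\<lambda>y. - (indicator (- \<G> n) y * rad (a * of_nat \<kappa>) y))
     (- ((1 - 1 / of_nat \<kappa>) * (a * of_nat \<kappa> / of_nat \<kappa>) powi n / (a * of_nat \<kappa> / of_nat \<kappa> - 1)))"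
    using a kappa_gt_1
    by (intro has_bochner_integral_minus rad_integral_compl) (simp add: norm_mult)
  moreover have "- ((1 - 1 / of_nat \<kappa>) * (a * of_nat \<kappa> / of_nat \<kappa>) powi n /
      (a * of_nat \<kappa> / of_nat \<kappa> - 1)) = ball_operator a n x"
    using True k by (simp only: ball_operator_def nonzero_mult_div_cancel_right
        if_True mult_minus_left minus_divide_left[symmetric] not_False_eq_True)
  moreover have "(indicator (\<G> n) (x - y) - indicator (\<G> n) x) * rad (a * of_nat \<kappa>) y =
      - (indicator (- \<G> n) y * rad (a * of_nat \<kappa>) y)" for y
    using True add_mem_iff_left[of x n "- y"] by (auto simp: indicator_def)
  ultimately show ?thesis by (simp only:)
next
  case False
  \<comment> \<open>The integrand is supported on a right coset of the ball, so its measure comes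
    from unimodularity through \<open>emeasure_right\<close>.\<close>
  let ?R = "(\<lambda>y. y + x) ` \<G> n"
  have R: "y \<in> ?R \<longleftrightarrow> x - y \<in> \<G> n" for y
  proof -
    have "y \<in> ?R \<longleftrightarrow> y - x \<in> \<G> n" by (force simp: image_iff algebra_simps)
    also have "\<dots> \<longleftrightarrow> - (x - y) \<in> \<G> n" by (simp only: minus_diff_eq)
    finally show ?thesis by (simp only: minus_mem_iff)
  qed
  have "?R = (\<lambda>y. x - y) -` \<G> n" using R by auto
  then have "open ?R" by (auto intro!: open_vimage "open" continuous_intros)
  then have "has_bochner_integral \<mu> (\<lambda>y. indicator ?R y *\<^sub>R rad (a * of_nat \<kappa>) x)
      (measure \<mu> ?R *\<^sub>R rad (a * of_nat \<kappa>) x)"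
    using emeasure_G_finite[of n] emeasure_right[of "\<G> n" x]
    by (intro has_bochner_integral_scaleR_left has_bochner_integral_real_indicator) auto
  moreover have "measure \<mu> ?R = \<kappa> powi (- n)"
    using emeasure_right[of "\<G> n" x] by (simp add: measure_def flip: measure_G)
  moreover have "(indicator (\<G> n) (x - y) - indicator (\<G> n) x) * rad (a * of_nat \<kappa>) y =
      indicator ?R y *\<^sub>R rad (a * of_nat \<kappa>) x" for y
  proof (cases "x - y \<in> \<G> n")
    case True
    \<comment> \<open>\<open>y\<close> equals \<open>- (x - y) + x\<close>, a translate of
      \<open>x\<close> by an element of a subgroup that does not contain \<open>x\<close>.\<close>
    have "rad r y = rad r x" for r
      using rad_add[OF False, of "- (x - y)" r] True minus_mem[OF True]
      by simp
    with True False show ?thesis by (simp add: R)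
  qed (simp add: R False)
  ultimately show ?thesis using False
    by (simp add: ball_operator_def scaleR_conv_of_real)
qed

text \<open>Since the radial factor is invariant under \<open>z \<mapsto> - z\<close>, left invariance alone suffices here.\<close>

lemma rad_integral_ball_translate:
  assumes r: "r \<noteq> 0" "norm r < \<kappa>" and x: "x \<in> \<G> m"
  shows "has_bochner_integral \<mu> (\<lambda>y. indicator (\<G> m) y * rad r (- y + x))
    ((1 - 1 / of_nat \<kappa>) * (r / of_nat \<kappa>) powi m / (1 - r / of_nat \<kappa>))"
proof (rule has_bochner_integral_left_translation[where x = x])
  have "indicator (\<G> m) (x + y) * rad r (- (x + y) + x) = indicator (\<G> m) y * rad r y" for y
    using x by (simp add: indicator_def add_mem_iff_left minus_add add.assoc)
  then show "has_bochner_integral \<mu> (\<lambda>y. indicator (\<G> m) (x + y) * rad r (- (x + y) + x))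
      ((1 - 1 / of_nat \<kappa>) * (r / of_nat \<kappa>) powi m / (1 - r / of_nat \<kappa>))"
    using rad_integral_ball[OF r] by simp
qed

section \<open>Convolution of these images with the kernel\<close>

context
  fixes a :: complex
  assumes a: "1 < norm a" "norm a \<noteq> \<kappa>"
begin

text \<open>With \<open>a\<close> standing for \<open>of_nat \<kappa> powr \<alpha>\<close>, this is
  the reciprocal of the product of the constants in front of the operator and of the kernel.\<close>

definition symbol_constant :: complex where
  "symbol_constant =
    (1 - 1 / (a * of_nat \<kappa>)) * (1 - a / of_nat \<kappa>) / ((1 - a) * (1 - 1 / a))"

lemma nonzero_constants:
  "a \<noteq> 0" "a \<noteq> 1" "complex_of_nat \<kappa> \<noteq> 0" "complex_of_nat \<kappa> \<noteq> 1" "a \<noteq> of_nat \<kappa>" "a * of_nat \<kappa> \<noteq> 1"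
proof -
  show "a \<noteq> 0" "a \<noteq> 1" "a \<noteq> of_nat \<kappa>" using a by auto
  show "complex_of_nat \<kappa> \<noteq> 0" "complex_of_nat \<kappa> \<noteq> 1" using order_ge_2 by auto
  have "1 * 1 < norm a * \<kappa>" using a kappa_gt_1 by (intro mult_strict_mono) auto
  then have "1 < norm (a * of_nat \<kappa>)" by (simp add: norm_mult)
  then show "a * of_nat \<kappa> \<noteq> 1" by auto
qed

text \<open>The radial part of the kernel is \<open>rad (of_nat \<kappa> / a)\<close>, and
  \<open>1 < norm a\<close> makes it integrable near the identity.\<close>

lemma kernel_ratio: "of_nat \<kappa> / a \<noteq> 0" "norm (of_nat \<kappa> / a) < \<kappa>"
  using a kappa_gt_1 by (auto simp: norm_divide divide_less_eq)

text \<open>The factors \<open>a\<close> cancel in the product, leaving the norm to the power -2,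
  which is integrable away from the identity.\<close>

lemma tail_integral:
  "has_bochner_integral \<mu>
    (\<lambda>y. indicator (- \<G> m) y * (rad (a * of_nat \<kappa>) y * rad (of_nat \<kappa> / a) y))
    (of_nat \<kappa> powi m / of_nat \<kappa>)"
proof -
  have "a * of_nat \<kappa> * (of_nat \<kappa> / a) = of_nat \<kappa> * complex_of_nat \<kappa>"
    using nonzero_constants by simp
  moreover have "(1 - 1 / complex_of_nat \<kappa>) * (of_nat \<kappa> * of_nat \<kappa> / of_nat \<kappa>) powi m /
      (of_nat \<kappa> * of_nat \<kappa> / of_nat \<kappa> - 1) = of_nat \<kappa> powi m / of_nat \<kappa>"
    using nonzero_constants by (simp add: field_simps)
  ultimately show ?thesis
    using rad_integral_compl[of "of_nat \<kappa> * of_nat \<kappa>" m] kappa_gt_1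
    by (simp add: rad_mult norm_mult)
qed

lemma ball_integral:
  assumes "x \<in> \<G> m"
  shows "has_bochner_integral \<mu> (\<lambda>y. indicator (\<G> m) y * rad (of_nat \<kappa> / a) (- y + x))
    ((1 - 1 / of_nat \<kappa>) / a powi m / (1 - 1 / a))"
  using rad_integral_ball_translate[OF kernel_ratio assms] nonzero_constants
  by (simp add: power_int_divide_distrib)

text \<open>
  The integral of \<open>ball_operator a n\<close> over the whole group vanishes, so its integral over a ball
  is minus the integral over the complement of the ball.
\<close>

lemma ball_operator_integral:
  assumes "m \<le> n"
  shows "has_bochner_integral \<mu> (\<lambda>y. indicator (\<G> m) y * ball_operator a n y)
    (- (of_nat \<kappa> powi (- n) * (1 - 1 / of_nat \<kappa>) * a powi m / (a - 1)))"
proof -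
  let ?k = "complex_of_nat \<kappa>"
  have compl: "has_bochner_integral \<mu>
      (\<lambda>y. ?k powi (- n) * (indicator (- \<G> j) y * rad (a * ?k) y))
      (?k powi (- n) * ((1 - 1 / ?k) * a powi j / (a - 1)))" for j
    using rad_integral_compl[of "a * ?k" j] a kappa_gt_1 nonzero_constants
    by (intro has_bochner_integral_mult_right) (simp_all add: norm_mult)
  have "has_bochner_integral \<mu>
      (\<lambda>y. indicator (\<G> n) y * (- (1 - 1 / ?k) * a powi n / (a - 1)) +
        (?k powi (- n) * (indicator (- \<G> n) y * rad (a * ?k) y) -
         ?k powi (- n) * (indicator (- \<G> m) y * rad (a * ?k) y)))
      (?k powi (- n) * (- (1 - 1 / ?k) * a powi n / (a - 1)) +
        (?k powi (- n) * ((1 - 1 / ?k) * a powi n / (a - 1)) -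
         ?k powi (- n) * ((1 - 1 / ?k) * a powi m / (a - 1))))"
    by (intro has_bochner_integral_add has_bochner_integral_diff
        has_bochner_integral_indicator_G compl)
  moreover have "indicator (\<G> m) y * ball_operator a n y =
      indicator (\<G> n) y * (- (1 - 1 / ?k) * a powi n / (a - 1)) +
        (?k powi (- n) * (indicator (- \<G> n) y * rad (a * ?k) y) -
         ?k powi (- n) * (indicator (- \<G> m) y * rad (a * ?k) y))" for y
    using antimono_G[OF assms] by (auto simp: indicator_def ball_operator_def)
  moreover have "?k powi (- n) * (- (1 - 1 / ?k) * a powi n / (a - 1)) +
        (?k powi (- n) * ((1 - 1 / ?k) * a powi n / (a - 1)) -
         ?k powi (- n) * ((1 - 1 / ?k) * a powi m / (a - 1))) =
      - (?k powi (- n) * (1 - 1 / ?k) * a powi m / (a - 1))"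
    by (simp only: mult_minus_left minus_divide_left[symmetric] mult_minus_right) simp
  ultimately show ?thesis by simp
qed

lemma ball_operator_convolution:
  "has_bochner_integral \<mu> (\<lambda>y. ball_operator a n y * rad (of_nat \<kappa> / a) (- y + x))
    (symbol_constant * indicator (\<G> n) x)"
proof (cases "x \<in> \<G> n")
  case True
  let ?k = "complex_of_nat \<kappa>"
  let ?c = "- (1 - 1 / ?k) * a powi n / (a - 1)"
  \<comment> \<open>On the ball the operator image is the constant \<open>?c\<close>. Off the ball
    \<open>x\<close> is negligible against \<open>y\<close>, so the kernel factor depends on
    \<open>y\<close> alone.\<close>
  have "has_bochner_integral \<mu>
      (\<lambda>y. ?c * (indicator (\<G> n) y * rad (?k / a) (- y + x)) +
        ?k powi (- n) * (indicator (- \<G> n) y * (rad (a * ?k) y * rad (?k / a) y)))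
      (?c * ((1 - 1 / ?k) / a powi n / (1 - 1 / a)) + ?k powi (- n) * (?k powi n / ?k))"
    by (intro has_bochner_integral_add has_bochner_integral_mult_right tail_integral
        ball_integral True)
  moreover have "ball_operator a n y * rad (?k / a) (- y + x) =
      ?c * (indicator (\<G> n) y * rad (?k / a) (- y + x)) +
        ?k powi (- n) * (indicator (- \<G> n) y * (rad (a * ?k) y * rad (?k / a) y))" for y
    using True by (simp add: ball_operator_def indicator_def rad_minus_add)
  moreover have "?c * ((1 - 1 / ?k) / a powi n / (1 - 1 / a)) + ?k powi (- n) * (?k powi n / ?k) =
      symbol_constant"
  proof -
    \<comment> \<open>All powers with exponent \<open>n\<close> cancel, so the value does not depend
      on the ball.\<close>
    have "?c * ((1 - 1 / ?k) / a powi n / (1 - 1 / a)) + ?k powi (- n) * (?k powi n / ?k) =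
        - (1 - 1 / ?k) / (a - 1) * ((1 - 1 / ?k) / (1 - 1 / a)) + 1 / ?k"
      using nonzero_constants by (simp add: power_int_minus)
    also have "\<dots> = symbol_constant"
      unfolding symbol_constant_def using nonzero_constants
      by (simp add: divide_simps) (simp add: algebra_simps)
    finally show ?thesis .
  qed
  ultimately show ?thesis using True by simp
next
  case False
  let ?k = "complex_of_nat \<kappa>"
  define m where "m = level x"
  have x0: "x \<noteq> 0" using False by auto
  have m: "m < n" "x \<in> \<G> m" "x \<notin> \<G> (m + 1)"
    using False x0 by (auto simp: m_def mem_G_iff_level)
  \<comment> \<open>\<open>e\<close> is the kernel factor for \<open>y\<close> in
    \<open>\<G> (m + 1)\<close>, where \<open>y\<close> is negligible against \<open>x\<close>;
    \<open>w\<close> is the operator image on the shell of level \<open>m\<close>.\<close>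
  define e where "e = rad (?k / a) x"
  define w where "w = ?k powi (- n) * (a * ?k) powi m"
  have e: "e = (?k / a) powi m" using x0 by (simp add: e_def m_def rad_def)
  \<comment> \<open>On the shell through \<open>x\<close> the kernel factor varies with
    \<open>y\<close>, so its integral is taken over \<open>\<G> m\<close> and the part over
    \<open>\<G> (m + 1)\<close>, where it equals \<open>e\<close>, is subtracted. Since
    \<open>m < n\<close>, the ball \<open>\<G> (m + 1)\<close> still contains \<open>\<G> n\<close>,
    as \<open>ball_operator_integral\<close> requires.\<close>
  have "has_bochner_integral \<mu>
      (\<lambda>y. e * (indicator (\<G> (m + 1)) y * ball_operator a n y) +
        (w * (indicator (\<G> m) y * rad (?k / a) (- y + x) - indicator (\<G> (m + 1)) y * e) +
        ?k powi (- n) * (indicator (- \<G> m) y * (rad (a * ?k) y * rad (?k / a) y))))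
      (e * (- (?k powi (- n) * (1 - 1 / ?k) * a powi (m + 1) / (a - 1))) +
        (w * ((1 - 1 / ?k) / a powi m / (1 - 1 / a) - ?k powi (- (m + 1)) * e) +
        ?k powi (- n) * (?k powi m / ?k)))"
    using m by (intro has_bochner_integral_add has_bochner_integral_mult_right tail_integral
        has_bochner_integral_diff has_bochner_integral_indicator_G
        ball_integral ball_operator_integral) auto
  moreover have "ball_operator a n y * rad (?k / a) (- y + x) =
      e * (indicator (\<G> (m + 1)) y * ball_operator a n y) +
        (w * (indicator (\<G> m) y * rad (?k / a) (- y + x) - indicator (\<G> (m + 1)) y * e) +
        ?k powi (- n) * (indicator (- \<G> m) y * (rad (a * ?k) y * rad (?k / a) y)))" for y
  proof -
    have mono: "\<G> (m + 1) \<subseteq> \<G> m" "\<G> n \<subseteq> \<G> (m + 1)" using m by (auto intro!: antimono_G)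
    consider "y \<in> \<G> (m + 1)" | "y \<in> \<G> m" "y \<notin> \<G> (m + 1)" | "y \<notin> \<G> m" by blast
    then show ?thesis
    proof cases
      case 1
      then have "rad (?k / a) (- y + x) = e" using m by (simp add: rad_minus_add e_def)
      with 1 mono show ?thesis by (auto simp: indicator_def)
    next
      case 2
      then have "y \<noteq> 0" "level y = m" using shell_iff[of y m] by auto
      with 2 mono show ?thesis by (auto simp: indicator_def ball_operator_def w_def rad_def)
    next
      case 3
      with m mono have "y \<notin> \<G> n" "y \<notin> \<G> (m + 1)" by auto
      with 3 m show ?thesis by (simp add: ball_operator_def rad_minus_add)
    qed
  qed
  moreover have "e * (- (?k powi (- n) * (1 - 1 / ?k) * a powi (m + 1) / (a - 1))) +
        (w * ((1 - 1 / ?k) / a powi m / (1 - 1 / a) - ?k powi (- (m + 1)) * e) +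
        ?k powi (- n) * (?k powi m / ?k)) = 0"
  proof -
    \<comment> \<open>Naming the powers reduces the cancellation of the three contributions to an
      identity of rational functions.\<close>
    define A K N where "A = a powi m" and "K = ?k powi m" and "N = ?k powi (- n)"
    have AK: "A \<noteq> 0" "K \<noteq> 0" using nonzero_constants by (auto simp: A_def K_def)
    have eqs: "e = K / A" "w = N * (A * K)" "a powi (m + 1) = a * A" "?k powi (- (m + 1)) = 1 / (K * ?k)"
      using nonzero_constants
      by (auto simp: e w_def A_def K_def N_def power_int_divide_distrib power_int_mult_distrib
          power_int_add power_int_diff power_int_minus field_simps)
    show ?thesis
      unfolding eqs A_def[symmetric] K_def[symmetric] N_def[symmetric]
      using AK nonzero_constants by (simp add: divide_simps) (simp add: algebra_simps)
  qed
  ultimately show ?thesis using False by simp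
qed

end

section \<open>Test functions as finite sums of coset indicators\<close>

text \<open>Compactness of the support makes local constancy uniform: one \<open>\<G> n\<close>
  serves all points. Summing over a set of cosets rather than over representatives counts each coset
  once, and \<open>SOME\<close> picks a point at which to evaluate \<open>f\<close>.\<close>

lemma coset_decomposition:
  assumes f: "f \<in> test_functions"
  obtains C n where "finite C" "C \<subseteq> range (\<lambda>b. (\<lambda>y. b + y) ` \<G> n)"
    "\<And>x. f x = (\<Sum>c\<in>C. f (SOME z. z \<in> c) * indicator c x)"
proof -
  define K where "K = closure {x. f x \<noteq> 0}"
  have K: "compact K" "\<And>x. x \<notin> K \<Longrightarrow> f x = 0"
    using f closure_subset[of "{x. f x \<noteq> 0}"] by (auto simp: test_functions_def K_def)
  have "\<exists>n. \<forall>z \<in> (\<lambda>y. x + y) ` \<G> n. f z = f x" for x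
  proof -
    obtain U where U: "open U" "x \<in> U" "f constant_on U" using f by (auto simp: test_functions_def)
    have "open ((\<lambda>y. x + y) -` U)" using U by (auto intro!: open_vimage continuous_intros)
    then obtain n where "\<G> n \<subseteq> (\<lambda>y. x + y) -` U" using nhds_basis U(2) by force
    then show ?thesis using U(2,3) unfolding constant_on_def by (intro exI[of _ n]) auto
  qed
  then obtain N where N: "\<And>x z. z \<in> (\<lambda>y. x + y) ` \<G> (N x) \<Longrightarrow> f z = f x" by metis
  have self: "x \<in> (\<lambda>y. x + y) ` \<G> n" for x n by (simp add: mem_left_coset)
  obtain X where X: "finite X" "K \<subseteq> (\<Union>x\<in>X. (\<lambda>y. x + y) ` \<G> (N x))"
  proof (rule compactE_image[OF K(1), of K "\<lambda>x. (\<lambda>y. x + y) ` \<G> (N x)"])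
    show "K \<subseteq> (\<Union>x\<in>K. (\<lambda>y. x + y) ` \<G> (N x))" using self by blast
  qed (auto intro: left_coset_open)
  \<comment> \<open>The largest index gives the smallest of the finitely many subgroups; the
    inserted 0 covers an empty \<open>X\<close>.\<close>
  define n where "n = Max (insert 0 (N ` X))"
  have n: "\<G> n \<subseteq> \<G> (N x)" if "x \<in> X" for x
    using X(1) that by (intro antimono_G) (simp add: n_def)
  have inv_K: "f (z + h) = f z" if z: "z \<in> K" and h: "h \<in> \<G> n" for z h
  proof -
    obtain x where x: "x \<in> X" "z \<in> (\<lambda>y. x + y) ` \<G> (N x)" using X(2) z by blast
    then have "- x + z \<in> \<G> (N x)" by (simp only: mem_left_coset)
    moreover have "h \<in> \<G> (N x)" using n[OF x(1)] h by blast
    ultimately have "- x + z + h \<in> \<G> (N x)" by (rule add_mem)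
    then have "z + h \<in> (\<lambda>y. x + y) ` \<G> (N x)" by (simp only: mem_left_coset add.assoc)
    with x(2) N show ?thesis by metis
  qed
  \<comment> \<open>If \<open>z\<close> is outside \<open>K\<close> but \<open>z + h\<close> is
    inside, \<open>inv_K\<close> applies at \<open>z + h\<close> with \<open>- h\<close>; if both
    are outside, both values are 0.\<close>
  have inv: "f (z + h) = f z" if "h \<in> \<G> n" for z h
  proof (cases "z \<in> K")
    case False
    show ?thesis
    proof (cases "z + h \<in> K")
      case True
      from inv_K[OF this, of "- h"] that show ?thesis by (simp add: add.assoc)
    next
      case False
      with \<open>z \<notin> K\<close> show ?thesis by (simp add: K(2))
    qed
  qed (use inv_K that in blast)
  obtain Y where Y: "Y \<subseteq> K" "finite Y" "K \<subseteq> (\<Union>x\<in>Y. (\<lambda>y. x + y) ` \<G> n)"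
  proof (rule compactE_image[OF K(1), of K "\<lambda>x. (\<lambda>y. x + y) ` \<G> n"])
    show "K \<subseteq> (\<Union>x\<in>K. (\<lambda>y. x + y) ` \<G> n)" using self by blast
  qed (auto intro: left_coset_open)
  define C where "C = (\<lambda>b. (\<lambda>y. b + y) ` \<G> n) ` Y"
  show thesis
  proof
    show "finite C" "C \<subseteq> range (\<lambda>b. (\<lambda>y. b + y) ` \<G> n)" using Y by (auto simp: C_def)
    have coset: "c = (\<lambda>y. x + y) ` \<G> n" if "c \<in> C" "x \<in> c" for c x
    proof -
      from that obtain b where "c = (\<lambda>y. b + y) ` \<G> n" by (auto simp: C_def)
      with that(2) show ?thesis using mem_left_coset_trans by metis
    qed
    fix x
    show "f x = (\<Sum>c\<in>C. f (SOME z. z \<in> c) * indicator c x)"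
    proof (cases "x \<in> \<Union>C")
      case True
      then obtain c where c: "c \<in> C" "x \<in> c" by blast
      have "(SOME z. z \<in> c) \<in> c" using c(2) by (rule someI)
      then have "- x + (SOME z. z \<in> c) \<in> \<G> n"
        using coset[OF c] by (simp only: mem_left_coset)
      from inv[OF this, of x] have val: "f (SOME z. z \<in> c) = f x" by simp
      have "(\<Sum>d\<in>C. f (SOME z. z \<in> d) * indicator d x) =
          (\<Sum>d\<in>C. if d = c then f (SOME z. z \<in> d) else 0)"
      proof (intro sum.cong refl)
        fix d assume "d \<in> C"
        then have "x \<in> d \<longleftrightarrow> d = c" using c coset by metis
        then show "f (SOME z. z \<in> d) * indicator d x =
            (if d = c then f (SOME z. z \<in> d) else 0)"
          by (simp add: indicator_def)
      qed
      then show ?thesis using c \<open>finite C\<close> val by simp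
    next
      case False
      then have "x \<notin> K" using Y(3) unfolding C_def by blast
      moreover have "(\<Sum>c\<in>C. f (SOME z. z \<in> c) * indicator c x) = 0"
        using False by (intro sum.neutral) (auto simp: indicator_def)
      ultimately show ?thesis by (simp add: K(2))
    qed
  qed
qed

section \<open>Superposition and translation\<close>

context
  fixes a :: complex
  assumes a: "1 < norm a" "norm a \<noteq> \<kappa>"
begin

text \<open>Bundles the integrability statements so that they propagate through finite sums.\<close>

definition solvable :: "('a \<Rightarrow> complex) \<Rightarrow> bool" where
  "solvable f \<longleftrightarrow>
    integrable \<mu> (\<lambda>x. rad (of_nat \<kappa> / a) x * f x) \<and>
    (\<exists>D. (\<forall>x. has_bochner_integral \<mu> (\<lambda>y. (f (x - y) - f x) * rad (a * of_nat \<kappa>) y) (D x)) \<and>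
      (\<forall>x. has_bochner_integral \<mu> (\<lambda>y. D y * rad (of_nat \<kappa> / a) (- y + x))
        (symbol_constant a * f x)))"

lemma solvable_zero: "solvable (\<lambda>x. 0)"
  unfolding solvable_def by (auto intro!: exI[of _ "\<lambda>x. 0"] has_bochner_integral_zero)

lemma solvable_add:
  assumes "solvable f" "solvable g"
  shows "solvable (\<lambda>x. f x + g x)"
proof -
  let ?k = "complex_of_nat \<kappa>"
  from assms obtain D E where
    f: "integrable \<mu> (\<lambda>x. rad (?k / a) x * f x)"
      "\<And>x. has_bochner_integral \<mu> (\<lambda>y. (f (x - y) - f x) * rad (a * ?k) y) (D x)"
      "\<And>x. has_bochner_integral \<mu> (\<lambda>y. D y * rad (?k / a) (- y + x)) (symbol_constant a * f x)" and
    g: "integrable \<mu> (\<lambda>x. rad (?k / a) x * g x)"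
      "\<And>x. has_bochner_integral \<mu> (\<lambda>y. (g (x - y) - g x) * rad (a * ?k) y) (E x)"
      "\<And>x. has_bochner_integral \<mu> (\<lambda>y. E y * rad (?k / a) (- y + x)) (symbol_constant a * g x)"
    unfolding solvable_def by blast
  show ?thesis unfolding solvable_def
    using Bochner_Integration.integrable_add[OF f(1) g(1)]
      has_bochner_integral_add[OF f(2) g(2)] has_bochner_integral_add[OF f(3) g(3)]
    by (intro conjI exI[of _ "\<lambda>x. D x + E x"]) (auto simp: algebra_simps)
qed

lemma solvable_cmult:
  assumes "solvable f"
  shows "solvable (\<lambda>x. c * f x)"
proof -
  let ?k = "complex_of_nat \<kappa>"
  from assms obtain D where
    f: "integrable \<mu> (\<lambda>x. rad (?k / a) x * f x)"
      "\<And>x. has_bochner_integral \<mu> (\<lambda>y. (f (x - y) - f x) * rad (a * ?k) y) (D x)"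
      "\<And>x. has_bochner_integral \<mu> (\<lambda>y. D y * rad (?k / a) (- y + x)) (symbol_constant a * f x)"
    unfolding solvable_def by blast
  show ?thesis unfolding solvable_def
    using integrable_mult_right[of c, OF f(1)]
      has_bochner_integral_mult_right[of c, OF f(2)] has_bochner_integral_mult_right[of c, OF f(3)]
    by (intro conjI exI[of _ "\<lambda>x. c * D x"]) (auto simp: algebra_simps)
qed

lemma solvable_sum: "(\<And>i. i \<in> I \<Longrightarrow> solvable (f i)) \<Longrightarrow> solvable (\<lambda>x. \<Sum>i\<in>I. f i x)"
  by (induction I rule: infinite_finite_induct) (auto intro: solvable_zero solvable_add)

lemma solvable_coset: "solvable (indicator ((\<lambda>y. b + y) ` \<G> n))"
proof -
  let ?k = "complex_of_nat \<kappa>" and ?c = "(\<lambda>y. b + y) ` \<G> n"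
  have ind: "indicator ?c x = (indicator (\<G> n) (- b + x) :: complex)" for x
    by (simp only: indicator_def mem_left_coset)
  \<comment> \<open>\<open>m\<close> is chosen so that \<open>\<G> m\<close> contains the whole
    coset, since integrability of the kernel is available over balls.\<close>
  obtain m where m: "b \<in> \<G> m" "m \<le> n"
  proof -
    obtain j where "b \<in> \<G> j" using Union by blast
    then show ?thesis using antimono_G[of "min j n" j] by (intro that[of "min j n"]) auto
  qed
  have "integrable \<mu> (\<lambda>x. indicator (\<G> m) x * rad (?k / a) x)"
    using rad_integral_ball[OF kernel_ratio[OF a]] by (rule integrable.intros)
  then have "integrable \<mu> (\<lambda>x. indicator ?c x *\<^sub>R (indicator (\<G> m) x * rad (?k / a) x))"
    using left_coset_open by (intro integrable_mult_indicator) auto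
  moreover have "?c \<subseteq> \<G> m" using m antimono_G[OF m(2)] by (auto intro: add_mem)
  then have "indicator ?c x *\<^sub>R (indicator (\<G> m) x * rad (?k / a) x) = rad (?k / a) x * indicator ?c x" for x
    by (auto simp: indicator_def)
  ultimately have "integrable \<mu> (\<lambda>x. rad (?k / a) x * indicator ?c x)" by simp
  moreover have "has_bochner_integral \<mu>
      (\<lambda>y. (indicator ?c (x - y) - indicator ?c x) * rad (a * ?k) y) (ball_operator a n (- b + x))" for x
    using has_bochner_integral_ball_operator[OF a(1), of n "- b + x"]
    unfolding ind by (simp add: add_diff_eq)
  moreover have "has_bochner_integral \<mu>
      (\<lambda>y. ball_operator a n (- b + y) * rad (?k / a) (- y + x)) (symbol_constant a * indicator ?c x)" for x
  \<comment> \<open>Replacing \<open>y\<close> by \<open>b + y\<close> turns the convolution at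
    \<open>x\<close> into the one for the ball at \<open>- b + x\<close>.\<close>
  proof (rule has_bochner_integral_left_translation[where x = b])
    show "has_bochner_integral \<mu>
      (\<lambda>y. ball_operator a n (- b + (b + y)) * rad (?k / a) (- (b + y) + x))
      (symbol_constant a * indicator ?c x)"
      using ball_operator_convolution[OF a, of n "- b + x"] unfolding ind
      by (simp add: minus_add add.assoc diff_conv_add_uminus del: add_uminus_conv_diff)
  qed
  ultimately show ?thesis unfolding solvable_def
    by (intro conjI exI[of _ "\<lambda>x. ball_operator a n (- b + x)"] allI)
qed

lemma test_function_solvable:
  assumes "f \<in> test_functions"
  shows "solvable f"
proof -
  obtain n C where "finite C" and C: "C \<subseteq> range (\<lambda>b. (\<lambda>y. b + y) ` \<G> n)"
    and f: "\<And>x. f x = (\<Sum>c\<in>C. f (SOME z. z \<in> c) * indicator c x)"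
    by (rule coset_decomposition[OF assms]) (rule that; assumption)
  have "solvable (\<lambda>x. \<Sum>c\<in>C. f (SOME z. z \<in> c) * indicator c x)"
    using C by (intro solvable_sum solvable_cmult) (auto intro: solvable_coset)
  then show ?thesis by (simp flip: f)
qed

end

section \<open>Complex powers and the normalising constants\<close>

text \<open>Off the identity the base is a positive real, so \<open>Ln\<close> is the real logarithm
  and the integer level can be pulled out of the exponent without branch ambiguity. At the identity
  both sides are 0.\<close>

lemma vnorm_powr:
  "complex_of_real (vnorm \<mu> \<G> x) powr s = rad (of_nat \<kappa> powr (- s)) x"
proof (cases "x = 0")
  case False
  define k where "k = level x"
  have pos: "0 < real \<kappa> powi (- k)" using kappa_gt_1 by simp
  have "complex_of_real (vnorm \<mu> \<G> x) powr s = exp (s * Ln (complex_of_real (real \<kappa> powi (- k))))"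
    using False kappa_gt_1 by (simp add: vnorm_def measure_G powr_def k_def flip: level_def)
  also have "Ln (complex_of_real (real \<kappa> powi (- k))) = complex_of_real (- k * ln \<kappa>)"
    using pos kappa_gt_1 by (subst Ln_of_real) (simp_all flip: powr_real_of_int' add: ln_powr)
  also have "exp (s * complex_of_real (- k * ln \<kappa>)) = exp (- s * ln (real \<kappa>)) powi k"
    by (simp add: exp_power_int algebra_simps)
  also have "exp (- s * ln (real \<kappa>)) = of_nat \<kappa> powr (- s)"
    using kappa_gt_1 Ln_of_real[of "real \<kappa>"] by (simp add: powr_def)
  finally show ?thesis using False by (simp add: rad_def k_def)
qed (simp add: vnorm_def)

lemma fundamental_solution:
  assumes "0 < Re \<alpha>" "Re \<alpha> \<noteq> 1"
  shows "is_fundamental_solution \<mu> \<G> \<kappa> \<alpha> (fundamental_kernel \<mu> \<G> \<kappa> \<alpha>)"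
proof -
  let ?k = "complex_of_nat \<kappa>"
  define a where "a = ?k powr \<alpha>"
  have norm_a: "norm a = real \<kappa> powr Re \<alpha>"
    unfolding a_def using norm_powr_real_powr[of "?k" \<alpha>] by simp
  \<comment> \<open>\<open>0 < Re \<alpha>\<close> gives the first bound, and injectivity of the
    real power turns \<open>Re \<alpha> \<noteq> 1\<close> into the second.\<close>
  have a: "1 < norm a" "norm a \<noteq> \<kappa>"
    using assms kappa_gt_1 powr_inj[of "real \<kappa>" "Re \<alpha>" 1] unfolding norm_a
    by (auto simp: gr_one_powr)
  note nz = nonzero_constants[OF a]
  have powrs: "?k powr (- \<alpha>) = 1 / a" "?k powr (\<alpha> - 1) = a / ?k" "?k powr (1 - \<alpha>) = ?k / a"
    "?k powr (- \<alpha> - 1) = 1 / (a * ?k)" "?k powr (- (\<alpha> + 1)) = 1 / (a * ?k)"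
    using nz by (simp_all add: a_def powr_diff powr_minus powr_add divide_inverse)
  define C where "C = (1 - a) / (1 - 1 / (a * ?k))"
  define E where "E = (1 - 1 / a) / (1 - a / ?k)"
  have kernel: "fundamental_kernel \<mu> \<G> \<kappa> \<alpha> x = E * rad (?k / a) x" for x
    by (simp add: fundamental_kernel_def vnorm_powr powrs E_def)
  have const: "C * E * symbol_constant a = 1"
  proof -
    have "1 - 1 / (a * ?k) \<noteq> 0" "1 - a / ?k \<noteq> 0" "1 - a \<noteq> 0" "1 - 1 / a \<noteq> 0"
      using nz by (auto simp: divide_simps)
    \<comment> \<open>Here \<open>r / p\<close> is \<open>C\<close>, \<open>s / q\<close> is
      \<open>E\<close>, and the last factor is \<open>symbol_constant a\<close>.\<close>
    moreover have "r / p * (s / q) * (p * q / (r * s)) = 1"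
      if "p \<noteq> 0" "q \<noteq> 0" "r \<noteq> 0" "s \<noteq> 0" for p q r s :: complex
      using that by simp
    ultimately show ?thesis unfolding C_def E_def symbol_constant_def[OF a] by blast
  qed
  \<comment> \<open>At \<open>y = 0\<close> the left side is a division by 0, whose value 0 agrees
    with \<open>rad\<close>.\<close>
  have weight: "z / complex_of_real (vnorm \<mu> \<G> y) powr (\<alpha> + 1) = z * rad (a * ?k) y" for z y
    unfolding vnorm_powr powrs by (simp add: rad_def power_int_divide_distrib)
  have oper: "vladimirov_taibleson \<mu> \<G> \<kappa> \<alpha> f x =
      C * (LINT y|\<mu>. (f (x - y) - f x) * rad (a * ?k) y)" for f x
    unfolding vladimirov_taibleson_def weight powrs C_def by (simp add: a_def)
  have int: "integrable \<mu> (\<lambda>x. fundamental_kernel \<mu> \<G> \<kappa> \<alpha> x * f x)" if "f \<in> test_functions" for f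
    using test_function_solvable[OF a that]
    by (auto simp: solvable_def[OF a] kernel mult.assoc)
  have "has_bochner_integral \<mu>
      (\<lambda>y. vladimirov_taibleson \<mu> \<G> \<kappa> \<alpha> f y * fundamental_kernel \<mu> \<G> \<kappa> \<alpha> (- y + x)) (f x)"
    if f: "f \<in> test_functions" for f x
  proof -
    obtain D where
      D: "\<And>x. has_bochner_integral \<mu> (\<lambda>y. (f (x - y) - f x) * rad (a * ?k) y) (D x)"
        "\<And>x. has_bochner_integral \<mu> (\<lambda>y. D y * rad (?k / a) (- y + x)) (symbol_constant a * f x)"
      using test_function_solvable[OF a f] unfolding solvable_def[OF a] by blast
    have eq: "vladimirov_taibleson \<mu> \<G> \<kappa> \<alpha> f y = C * D y" for y
      unfolding oper using D(1)[of y] by (simp add: has_bochner_integral_iff)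
    have "has_bochner_integral \<mu> (\<lambda>y. C * E * (D y * rad (?k / a) (- y + x)))
        (C * E * (symbol_constant a * f x))"
      by (intro has_bochner_integral_mult_right D)
    moreover have "C * E * (symbol_constant a * f x) = f x"
      using const by (simp flip: mult.assoc)
    ultimately have "has_bochner_integral \<mu> (\<lambda>y. C * E * (D y * rad (?k / a) (- y + x))) (f x)"
      by (simp only:)
    then show ?thesis by (simp add: eq kernel mult_ac)
  qed
  moreover have "is_distribution (regular_distribution \<mu> (fundamental_kernel \<mu> \<G> \<kappa> \<alpha>))"
    unfolding is_distribution_def regular_distribution_def
  proof (intro ballI allI)
    fix f g :: "'a \<Rightarrow> complex" and b c :: complex
    let ?E = "fundamental_kernel \<mu> \<G> \<kappa> \<alpha>"
    assume "f \<in> test_functions" "g \<in> test_functions"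
    then have "integrable \<mu> (\<lambda>x. ?E x * f x)" "integrable \<mu> (\<lambda>x. ?E x * g x)" by (auto intro: int)
    then have "(LINT x|\<mu>. b * (?E x * f x) + c * (?E x * g x)) =
        b * (LINT x|\<mu>. ?E x * f x) + c * (LINT x|\<mu>. ?E x * g x)"
      by simp
    then show "(LINT x|\<mu>. ?E x * (b * f x + c * g x)) =
        b * (LINT x|\<mu>. ?E x * f x) + c * (LINT x|\<mu>. ?E x * g x)"
      by (simp add: algebra_simps)
  qed
  ultimately show ?thesis
    unfolding is_fundamental_solution_def group_convolution_def
    using int by (auto simp: has_bochner_integral_iff)
qed

end

theorem theorem1p8:
  fixes \<G> :: "int \<Rightarrow> 'a::{topological_group_add, t2_space} set"
    and \<kappa> :: nat and \<mu> :: "'a measure" and \<alpha> :: complex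
  assumes "constant_order_vilenkin_group \<G> \<kappa>"
    and "left_haar_measure \<mu>" and "emeasure \<mu> (\<G> 0) = 1"
    and "Re \<alpha> > 0"
    and "\<alpha> \<notin> range (\<lambda>k :: int. 2 * complex_of_real pi * \<i> / complex_of_real (ln (real \<kappa>)) * of_int k)"
    and "Re \<alpha> \<noteq> 1"
  shows "is_fundamental_solution \<mu> \<G> \<kappa> \<alpha> (fundamental_kernel \<mu> \<G> \<kappa> \<alpha>)"
proof -
  interpret constant_order_vilenkin_group \<G> \<kappa> by fact
  interpret haar_vilenkin_group \<G> \<kappa> \<mu> by unfold_locales fact+
  show ?thesis using assms by (intro fundamental_solution)
qed

end
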